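(* There are positive constants $v,C_1$ and $C_2$, independent of $N$, such that for every $N\ge2$ and every $\xi\in\mathbb{N}^N$, $$\mathcal{L}^N\psi(\xi)\le-v\,\psi(\xi)+C_1\frac{R^2(\xi)}{N}+C_2 .$$
   Context: $\mathbb{N}=\{1,2,\dots\}$. Galton-Watson rates: $p$ is a probability distribution on $\mathbb{N}\cup\{0\}$ such that $\sum_{\ell\ge0}p(\ell)e^{\sigma\ell}<\infty$ for some $\sigma>0$ and $\sum_{\ell\ge-1}\ell\,p(\ell+1)<0$ (subcriticality). For $x\ne y$ in $\mathbb{N}\cup\{0\}$: $q(x,y)=x\,p(0)$ if $y=x-1\ge0$, $q(x,y)=x\,p(y-x+1)$ if $y>x\ge1$, and $q(x,y)=0$ otherwise. Fleming-Viot generator with $N\ge2$ particles: with $m(x,\xi)=\frac1N\sum_{i=1}^N\mathbf{1}_{\{\xi(i)=x\}}$ for $\xi\in\mathbb{N}^N$, $$\mathcal{L}^Nf(\xi)=\sum_{i=1}^N\sum_{y=1}^\infty\Big[q(\xi(i),y)+q(\xi(i),0)\tfrac{N}{N-1}m(y,\xi)\Big]\,[f(\xi^{i,y})-f(\xi)],$$ where $\xi^{i,y}(i)=y$ and $\xi^{i,y}(j)=\xi(j)$ for $j\ne i$. This formula is also used for the unbounded function $\psi$ below, for which the sum is well defined. $\psi(\xi):=\dfrac{\sum_{1\le i\le N}\xi^2(i)}{\sum_{1\le i\le N}\xi(i)}$ and $R(\xi):=\max_{1\le i\le N}\xi(i)$, where $\xi^2(i)=(\xi(i))^2$. *)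

theory Defs
  imports "HOL-Probability.Probability"
begin

definition exp_moment :: "nat pmf \<Rightarrow> bool" where
  "exp_moment p \<longleftrightarrow>
     (\<exists>\<sigma>::real. \<sigma> > 0 \<and> (\<lambda>l. pmf p l * exp (\<sigma> * real l)) summable_on UNIV)"

text \<open>The exponential moment makes the series below absolutely summable, so \<^const>\<open>infsum\<close>
  does not take its default value there.\<close>
definition subcritical :: "nat pmf \<Rightarrow> bool" where
  "subcritical p \<longleftrightarrow>
     (\<Sum>\<^sub>\<infinity>l\<in>{-1::int..}. real_of_int l * pmf p (nat (l + 1))) < 0"

text \<open>The rates are only meaningful off the diagonal. The value on the diagonal is immaterial in
  the generator, because it multiplies a vanishing increment.\<close>
definition gw_rate :: "nat pmf \<Rightarrow> nat \<Rightarrow> nat \<Rightarrow> real" where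
  "gw_rate p x y =
     (if y + 1 = x then real x * pmf p 0
      else if 1 \<le> x \<and> x < y then real x * pmf p (y - x + 1)
      else 0)"

text \<open>A configuration assigns to each particle in \<open>{1..N}\<close> a positive site. The extensional
  function space makes it an \<open>N\<close>-tuple.\<close>
definition configs :: "nat \<Rightarrow> (nat \<Rightarrow> nat) set" where
  "configs N = {1..N} \<rightarrow>\<^sub>E {1..}"

definition emp_measure :: "nat \<Rightarrow> nat \<Rightarrow> (nat \<Rightarrow> nat) \<Rightarrow> real" where
  "emp_measure N x \<xi> = (1 / real N) * (\<Sum>i=1..N. if \<xi> i = x then 1 else 0)"

definition fv_gen :: "nat pmf \<Rightarrow> nat \<Rightarrow> ((nat \<Rightarrow> nat) \<Rightarrow> real) \<Rightarrow> (nat \<Rightarrow> nat) \<Rightarrow> real" where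
  "fv_gen p N f \<xi> =
     (\<Sum>i=1..N. \<Sum>\<^sub>\<infinity>y\<in>{1..}.
        (gw_rate p (\<xi> i) y
          + gw_rate p (\<xi> i) 0 * (real N / (real N - 1)) * emp_measure N y \<xi>)
        * (f (\<xi>(i := y)) - f \<xi>))"

definition psi :: "nat \<Rightarrow> (nat \<Rightarrow> nat) \<Rightarrow> real" where
  "psi N \<xi> = (\<Sum>i=1..N. (real (\<xi> i))\<^sup>2) / (\<Sum>i=1..N. real (\<xi> i))"

definition rightmost :: "nat \<Rightarrow> (nat \<Rightarrow> nat) \<Rightarrow> nat" where
  "rightmost N \<xi> = Max (\<xi> ` {1..N})"

end

theory Submission
  imports Defs
begin

text \<open>
  Write \<open>S\<close> and \<open>Q\<close> for the sums of \<open>\<xi> i\<close> and of \<open>(\<xi> i)\<^sup>2\<close>, so that \<open>\<psi> = Q / S\<close>. Moving one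
  particle from \<open>a\<close> to \<open>a + d\<close> changes \<open>\<psi>\<close> by exactly \<open>d * (2 * a + d - \<psi>) / (S + d)\<close>. Replacing
  the denominator by \<open>S\<close> costs at most \<open>2 * \<psi> * d\<^sup>2 / S\<^sup>2\<close> in the upward direction
  (\<open>psi_increment_le\<close>), and what remains is a quadratic polynomial in \<open>d\<close>. Hence only two moments
  of the offspring law matter: the drift \<open>-\<mu> < 0\<close> and the second moment \<open>s\<close> of the displacement
  (\<open>displacement_moments\<close>).

  If every particle, including those at site 1, could branch freely, the leading part of the
  branching would contribute the sum over \<open>i\<close> of \<open>-\<mu> * \<xi> i * (2 * \<xi> i - \<psi>) / S\<close>, which is exactly
  \<open>-\<mu> * \<psi>\<close>: the dissipation in the statement.

  The selection mechanism only concerns the particles at site 1. Such a particle, instead of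
  jumping to \<open>0\<close>, copies a uniformly chosen other particle. Suppressing the jump to \<open>0\<close> gains
  \<open>p(0) * (\<psi> - 1) / S\<close>, whereas the leading part of the copying costs
  \<open>p(0) * (N / (N - 1)) * (\<psi> - 1) / S\<close>, because averaging \<open>b\<^sup>2 - 1 - \<psi> * (b - 1)\<close> over the
  configuration gives \<open>\<psi> - 1\<close>. The two nearly cancel; the difference is of order \<open>\<psi> / (N * S)\<close> for
  each of the at most \<open>N \<le> S\<close> particles (\<open>particle_contribution_le\<close>).

  Apart from the constant \<open>s\<close>, all remaining terms are of order \<open>\<psi>\<^sup>2 / N\<close> or \<open>\<psi> / S\<close>, and \<open>1 \<le> \<psi> \<le> R\<close> together with
  \<open>N \<le> S\<close> bounds them by \<open>R\<^sup>2 / N\<close>.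
\<close>

section \<open>Moments of the displacement\<close>

lemma abs_le_square_if_Ints:
  fixes x :: real
  assumes "x \<in> \<int>"
  shows "\<bar>x\<bar> \<le> x\<^sup>2"
proof (cases "x = 0")
  case False
  then have "\<bar>x\<bar> \<ge> 1" using assms by (rule Ints_nonzero_abs_ge1[rotated])
  then have "\<bar>x\<bar> * 1 \<le> \<bar>x\<bar> * \<bar>x\<bar>" by (intro mult_left_mono) auto
  then show ?thesis by (simp add: power2_eq_square)
qed simp

text \<open>The exponential moment enters only through \<open>k\<^sup>2 \<le> (2 / \<sigma>\<^sup>2) * exp (\<sigma> * k)\<close>, which gives a second
  moment and hence also the first. The drift is the sum defining subcriticality, shifted by one.\<close>
lemma displacement_moments:
  assumes "exp_moment p" and "subcritical p"
  obtains \<mu> s where "\<mu> > 0" "s \<ge> 0"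
    "((\<lambda>k. pmf p k * (real k - 1)) has_sum - \<mu>) UNIV"
    "((\<lambda>k. pmf p k * (real k - 1)\<^sup>2) has_sum s) UNIV"
proof -
  obtain \<sigma> :: real where \<sigma>: "\<sigma> > 0"
    and summ: "(\<lambda>l. pmf p l * exp (\<sigma> * real l)) summable_on UNIV"
    using assms(1) unfolding exp_moment_def by blast
  have sq_le_exp: "(real k - 1)\<^sup>2 \<le> (2 / \<sigma>\<^sup>2 + 1) * exp (\<sigma> * real k)" for k
  proof -
    have "1 + \<sigma> * real k + (\<sigma> * real k)\<^sup>2 / 2 \<le> exp (\<sigma> * real k)"
      using \<sigma> by (intro exp_lower_Taylor_quadratic) auto
    moreover have "0 \<le> \<sigma> * real k" "0 \<le> (\<sigma> * real k)\<^sup>2 / 2"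
      using \<sigma> by auto
    ultimately have e: "1 \<le> exp (\<sigma> * real k)" "(\<sigma> * real k)\<^sup>2 / 2 \<le> exp (\<sigma> * real k)"
      by linarith+
    have "(real k)\<^sup>2 = (2 / \<sigma>\<^sup>2) * ((\<sigma> * real k)\<^sup>2 / 2)"
      using \<sigma> by (simp add: power_mult_distrib)
    also have "\<dots> \<le> (2 / \<sigma>\<^sup>2) * exp (\<sigma> * real k)"
      by (intro mult_left_mono e) auto
    finally have "(real k)\<^sup>2 \<le> (2 / \<sigma>\<^sup>2) * exp (\<sigma> * real k)" .
    moreover have "(real k - 1)\<^sup>2 \<le> (real k)\<^sup>2 + 1"
      by (simp add: power2_diff)
    ultimately show ?thesis
      using e(1) unfolding distrib_right by linarith
  qed
  have summ2: "(\<lambda>k. pmf p k * (real k - 1)\<^sup>2) summable_on UNIV"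
  proof (rule summable_on_comparison_test)
    show "(\<lambda>k. (2 / \<sigma>\<^sup>2 + 1) * (pmf p k * exp (\<sigma> * real k))) summable_on UNIV"
      by (intro summable_on_cmult_right summ)
    show "pmf p k * (real k - 1)\<^sup>2 \<le> (2 / \<sigma>\<^sup>2 + 1) * (pmf p k * exp (\<sigma> * real k))" for k
      using mult_left_mono[OF sq_le_exp[of k], of "pmf p k"] by (simp add: algebra_simps)
  qed simp
  have abs_le_sq: "\<bar>real k - 1\<bar> \<le> (real k - 1)\<^sup>2" for k
    by (rule abs_le_square_if_Ints) auto
  have summ1: "(\<lambda>k. pmf p k * (real k - 1)) summable_on UNIV"
  proof (rule summable_on_iff_abs_summable_on_real[THEN iffD2], rule Infinite_Sum.abs_summable_on_comparison_test'[OF summ2])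
    show "norm (pmf p k * (real k - 1)) \<le> pmf p k * (real k - 1)\<^sup>2" for k
      using abs_le_sq[of k] by (simp add: abs_mult mult_left_mono)
  qed
  have "(\<Sum>\<^sub>\<infinity>l\<in>{-1::int..}. real_of_int l * pmf p (nat (l + 1)))
      = (\<Sum>\<^sub>\<infinity>k. pmf p k * (real k - 1))"
    by (rule infsum_reindex_bij_witness[where i = "\<lambda>k. int k - 1" and j = "\<lambda>l. nat (l + 1)"])
      (auto simp: mult.commute)
  then have neg: "(\<Sum>\<^sub>\<infinity>k. pmf p k * (real k - 1)) < 0"
    using assms(2) unfolding subcritical_def by simp
  show ?thesis
  proof
    show "- (\<Sum>\<^sub>\<infinity>k. pmf p k * (real k - 1)) > 0"
      using neg by simp
    show "(\<Sum>\<^sub>\<infinity>k. pmf p k * (real k - 1)\<^sup>2) \<ge> 0"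
      by (intro infsum_nonneg) auto
  qed (use has_sum_infsum[OF summ1] has_sum_infsum[OF summ2] in auto)
qed

section \<open>Sums against the jump rates\<close>

text \<open>A particle at \<open>a\<close> is replaced at rate \<open>a\<close> by \<open>k\<close> offspring, which moves it to \<open>a + k - 1\<close>.
  Restricting to positive targets removes exactly the extinction event \<open>a = 1\<close>, \<open>k = 0\<close>. The
  hypothesis \<open>g a = 0\<close> absorbs the diagonal \<open>k = 1\<close>, where the rate is set to zero.\<close>
lemma has_sum_gw_rate:
  fixes g :: "nat \<Rightarrow> real"
  assumes a: "a \<ge> 1" and ga: "g a = 0"
    and M: "((\<lambda>k. pmf p k * g (a + k - 1)) has_sum M) UNIV"
  shows "((\<lambda>y. gw_rate p a y * g y) has_sum
    (real a * M - (if a = 1 then pmf p 0 * g 0 else 0))) {1..}"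
proof -
  have "((\<lambda>k. real a * (pmf p k * g (a + k - 1))) has_sum (real a * M)) UNIV"
    by (intro has_sum_cmult_right M)
  also have "?this \<longleftrightarrow> ((\<lambda>y. gw_rate p a y * g y) has_sum (real a * M)) {a - 1..}"
  proof (rule has_sum_reindex_bij_witness[where i = "\<lambda>y. y + 1 - a" and j = "\<lambda>k. a + k - 1"])
    fix k :: nat
    consider "k = 0" | "k = 1" | "k \<ge> 2" by linarith
    then show "gw_rate p a (a + k - 1) * g (a + k - 1) = real a * (pmf p k * g (a + k - 1))"
      by cases (use a ga in \<open>auto simp: gw_rate_def\<close>)
  qed (use a in auto)
  finally have all: "((\<lambda>y. gw_rate p a y * g y) has_sum (real a * M)) {a - 1..}" .
  show ?thesis
  proof (cases "a = 1")
    case True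
    have zero: "((\<lambda>y. gw_rate p a y * g y) has_sum (gw_rate p a 0 * g 0)) {0}"
      using has_sum_finite[of "{0}" "\<lambda>y. gw_rate p a y * g y"] by simp
    have "((\<lambda>y. gw_rate p a y * g y) has_sum (real a * M - gw_rate p a 0 * g 0)) ({a - 1..} - {0})"
      by (rule has_sum_Diff[OF all zero]) (use True in auto)
    moreover have "{a - 1..} - {0} = {1..}"
      using True by auto
    ultimately show ?thesis
      using True by (simp add: gw_rate_def)
  next
    case False
    have "((\<lambda>y. gw_rate p a y * g y) has_sum (real a * M)) {a - 1..}
        \<longleftrightarrow> ((\<lambda>y. gw_rate p a y * g y) has_sum (real a * M)) {1..}"
      by (rule has_sum_cong_neutral) (use False a in \<open>auto simp: gw_rate_def\<close>)
    with all False show ?thesis by simp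
  qed
qed

lemma has_sum_emp_measure:
  fixes g :: "nat \<Rightarrow> real"
  assumes pos: "\<And>j. j \<in> {1..N} \<Longrightarrow> \<xi> j \<ge> 1"
  shows "((\<lambda>y. emp_measure N y \<xi> * g y) has_sum ((\<Sum>j=1..N. g (\<xi> j)) / real N)) {1..}"
proof -
  have "(\<Sum>y\<in>\<xi> ` {1..N}. emp_measure N y \<xi> * g y)
      = (\<Sum>y\<in>\<xi> ` {1..N}. \<Sum>j=1..N. (if \<xi> j = y then g y else 0) / real N)"
    by (intro sum.cong refl)
      (auto simp: emp_measure_def sum_distrib_left sum_distrib_right sum_divide_distrib
        intro!: sum.cong)
  also have "\<dots> = (\<Sum>j=1..N. \<Sum>y\<in>\<xi> ` {1..N}. (if \<xi> j = y then g y else 0) / real N)"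
    by (rule sum.swap)
  also have "\<dots> = (\<Sum>j=1..N. g (\<xi> j) / real N)"
    by (intro sum.cong refl) (auto simp: sum_divide_distrib[symmetric])
  finally have "(\<Sum>y\<in>\<xi> ` {1..N}. emp_measure N y \<xi> * g y) = (\<Sum>j=1..N. g (\<xi> j)) / real N"
    by (simp add: sum_divide_distrib)
  then have fin: "((\<lambda>y. emp_measure N y \<xi> * g y) has_sum ((\<Sum>j=1..N. g (\<xi> j)) / real N)) (\<xi> ` {1..N})"
    using has_sum_finite[of "\<xi> ` {1..N}" "\<lambda>y. emp_measure N y \<xi> * g y"] by simp
  have "emp_measure N y \<xi> = 0" if "y \<notin> \<xi> ` {1..N}" for y
    unfolding emp_measure_def using that by (auto intro!: sum.neutral)
  then have "((\<lambda>y. emp_measure N y \<xi> * g y) has_sum ((\<Sum>j=1..N. g (\<xi> j)) / real N)) (\<xi> ` {1..N})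
      \<longleftrightarrow> ((\<lambda>y. emp_measure N y \<xi> * g y) has_sum ((\<Sum>j=1..N. g (\<xi> j)) / real N)) {1..}"
    by (intro has_sum_cong_neutral) (use pos in auto)
  with fin show ?thesis by simp
qed

section \<open>Increments of \<open>psi\<close>\<close>

definition total :: "nat \<Rightarrow> (nat \<Rightarrow> nat) \<Rightarrow> real" where
  "total N \<xi> = (\<Sum>i=1..N. real (\<xi> i))"

lemma total_ge:
  assumes "\<xi> \<in> configs N"
  shows "total N \<xi> \<ge> real N"
proof -
  have "(\<Sum>i=1..N. 1) \<le> total N \<xi>"
    unfolding total_def using assms by (intro sum_mono) (force simp: configs_def)
  then show ?thesis by simp
qed

lemma psi_mult_total:
  assumes "total N \<xi> > 0"
  shows "psi N \<xi> * total N \<xi> = (\<Sum>i=1..N. (real (\<xi> i))\<^sup>2)"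
  using assms unfolding psi_def total_def by simp

lemma psi_ge_1:
  assumes "\<xi> \<in> configs N" and "N \<ge> 1"
  shows "psi N \<xi> \<ge> 1"
proof -
  have "total N \<xi> \<le> (\<Sum>i=1..N. (real (\<xi> i))\<^sup>2)"
    unfolding total_def
  proof (intro sum_mono)
    fix i assume "i \<in> {1..N}"
    then have "real (\<xi> i) \<ge> 1" using assms by (force simp: configs_def)
    then show "real (\<xi> i) \<le> (real (\<xi> i))\<^sup>2" by (simp add: power2_eq_square)
  qed
  moreover have "total N \<xi> > 0" using total_ge[OF assms(1)] assms(2) by simp
  ultimately show ?thesis unfolding psi_def total_def by simp
qed

lemma psi_le_rightmost:
  assumes "\<xi> \<in> configs N" and "N \<ge> 1"
  shows "psi N \<xi> \<le> real (rightmost N \<xi>)"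
proof -
  have "(\<Sum>i=1..N. (real (\<xi> i))\<^sup>2) \<le> (\<Sum>i=1..N. real (rightmost N \<xi>) * real (\<xi> i))"
    unfolding power2_eq_square
    by (intro sum_mono mult_right_mono) (auto simp: rightmost_def intro!: Max_ge)
  also have "\<dots> = real (rightmost N \<xi>) * total N \<xi>"
    by (simp add: total_def sum_distrib_left)
  finally show ?thesis
    using total_ge[OF assms(1)] assms(2)
    unfolding psi_def total_def by (simp add: divide_le_eq)
qed

lemma psi_increment:
  assumes i: "i \<in> {1..N}" and S: "total N \<xi> \<noteq> 0"
    and S': "total N \<xi> + (real b - real (\<xi> i)) \<noteq> 0"
  shows "psi N (\<xi>(i := b)) - psi N \<xi>
    = (real b - real (\<xi> i)) * (real b + real (\<xi> i) - psi N \<xi>)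
        / (total N \<xi> + (real b - real (\<xi> i)))"
proof -
  let ?Q = "\<Sum>j=1..N. (real (\<xi> j))\<^sup>2"
  have "(\<Sum>j=1..N. (real ((\<xi>(i := b)) j))\<^sup>2) = ?Q + ((real b)\<^sup>2 - (real (\<xi> i))\<^sup>2)"
    using i by (simp add: sum.remove[of _ i] cong: if_cong)
  moreover have "(\<Sum>j=1..N. real ((\<xi>(i := b)) j)) = total N \<xi> + (real b - real (\<xi> i))"
    using i by (simp add: total_def sum.remove[of _ i] cong: if_cong)
  ultimately have upd: "psi N (\<xi>(i := b))
      = (?Q + ((real b)\<^sup>2 - (real (\<xi> i))\<^sup>2)) / (total N \<xi> + (real b - real (\<xi> i)))"
    by (simp add: psi_def)
  have psi: "psi N \<xi> = ?Q / total N \<xi>"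
    by (simp add: psi_def total_def)
  show ?thesis
    unfolding upd psi using S S' by (simp add: field_simps power2_eq_square)
qed

text \<open>The quadratic majorant of the increment of \<open>\<psi>\<close> when a particle at \<open>a\<close> is displaced by \<open>d\<close>:
  the increment with its denominator \<open>S + d\<close> replaced by \<open>S\<close>, plus the price of the replacement.\<close>
definition increment_bound :: "real \<Rightarrow> real \<Rightarrow> real \<Rightarrow> real \<Rightarrow> real" where
  "increment_bound S \<psi> a d = d * (2 * a + d - \<psi>) / S + 2 * \<psi> * d\<^sup>2 / S\<^sup>2"

text \<open>Changing the denominator from \<open>S + d\<close> to \<open>S\<close> leaves the error
  \<open>- d\<^sup>2 * (2 * a + d - \<psi>) / (S * (S + d))\<close>, in which only the term with \<open>\<psi>\<close> has the wrong sign.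
  Since \<open>d \<ge> -1\<close> and \<open>S \<ge> 2\<close>, the denominator \<open>S + d\<close> is at least \<open>S / 2\<close>.\<close>
lemma increment_le_bound:
  fixes S \<psi> a d :: real
  assumes S: "S \<ge> 2" and \<psi>: "\<psi> \<ge> 0" and d: "d \<ge> -1" and a: "2 * a + d \<ge> 0"
  shows "d * (2 * a + d - \<psi>) / (S + d) \<le> increment_bound S \<psi> a d"
proof -
  have Sd: "S + d \<ge> S / 2" "S + d > 0" using S d by linarith+
  have "d * (2 * a + d - \<psi>) / (S + d)
      = d * (2 * a + d - \<psi>) / S - d\<^sup>2 * (2 * a + d) / (S * (S + d)) + \<psi> * d\<^sup>2 / (S * (S + d))"
  proof -
    have "x / (S + d) = x / S - d * x / (S * (S + d))" for x
      using S Sd(2) by (simp add: divide_simps) (simp add: algebra_simps)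
    moreover have "d * (d * (2 * a + d - \<psi>)) = d\<^sup>2 * (2 * a + d) - \<psi> * d\<^sup>2"
      by (simp add: algebra_simps power2_eq_square)
    ultimately show ?thesis by (simp add: diff_divide_distrib)
  qed
  also have "\<dots> \<le> d * (2 * a + d - \<psi>) / S + \<psi> * d\<^sup>2 / (S * (S + d))"
    using S Sd(2) a by simp
  also have "\<psi> * d\<^sup>2 / (S * (S + d)) \<le> \<psi> * d\<^sup>2 / (S * (S / 2))"
    using S Sd \<psi> by (intro divide_left_mono mult_left_mono mult_pos_pos) auto
  also have "\<psi> * d\<^sup>2 / (S * (S / 2)) = 2 * \<psi> * d\<^sup>2 / S\<^sup>2"
    by (simp add: power2_eq_square)
  finally show ?thesis unfolding increment_bound_def by simp
qed

lemma psi_increment_le: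
  assumes \<xi>: "\<xi> \<in> configs N" and N: "N \<ge> 2" and i: "i \<in> {1..N}" and b: "b + 1 \<ge> \<xi> i"
  shows "psi N (\<xi>(i := b)) - psi N \<xi>
    \<le> increment_bound (total N \<xi>) (psi N \<xi>) (real (\<xi> i)) (real b - real (\<xi> i))"
proof -
  have S: "total N \<xi> \<ge> 2" using total_ge[OF \<xi>] N by simp
  have d: "real b - real (\<xi> i) \<ge> -1" using b by linarith
  have sum_eq: "real b + real (\<xi> i) - psi N \<xi>
      = 2 * real (\<xi> i) + (real b - real (\<xi> i)) - psi N \<xi>"
    by simp
  have "psi N (\<xi>(i := b)) - psi N \<xi>
      = (real b - real (\<xi> i)) * (2 * real (\<xi> i) + (real b - real (\<xi> i)) - psi N \<xi>)
        / (total N \<xi> + (real b - real (\<xi> i)))"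
    unfolding sum_eq[symmetric] using S d by (intro psi_increment[OF i]) auto
  also have "\<dots> \<le> increment_bound (total N \<xi>) (psi N \<xi>) (real (\<xi> i)) (real b - real (\<xi> i))"
    using psi_ge_1[OF \<xi>] N by (intro increment_le_bound S d) auto
  finally show ?thesis .
qed

section \<open>Contribution of a single particle\<close>

text \<open>The branching part. Besides taking the expectation of the quadratic majorant, one needs that
  the increments themselves are summable: since the displacement \<open>d = k - 1\<close> is an integer,
  \<open>\<bar>d\<bar> \<le> d\<^sup>2\<close>, so the increment is at most a constant times \<open>d\<^sup>2\<close>.\<close>
lemma branching_sum_le:
  fixes p :: "nat pmf"
  assumes \<xi>: "\<xi> \<in> configs N" and N: "N \<ge> 2" and i: "i \<in> {1..N}"
    and drift: "((\<lambda>k. pmf p k * (real k - 1)) has_sum - \<mu>) UNIV"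
    and second: "((\<lambda>k. pmf p k * (real k - 1)\<^sup>2) has_sum s) UNIV"
  defines "G \<equiv> \<lambda>y. psi N (\<xi>(i := y)) - psi N \<xi>"
    and "S \<equiv> total N \<xi>" and "\<psi> \<equiv> psi N \<xi>" and "a \<equiv> real (\<xi> i)"
  shows "(\<lambda>y. gw_rate p (\<xi> i) y * G y) summable_on {1..}"
    and "(\<Sum>\<^sub>\<infinity>y\<in>{1..}. gw_rate p (\<xi> i) y * G y)
      \<le> a * (- \<mu> * (2 * a - \<psi>) / S + s * (1 / S + 2 * \<psi> / S\<^sup>2))
         - (if \<xi> i = 1 then pmf p 0 * (\<psi> - 1) / S else 0)"
proof -
  have a1: "\<xi> i \<ge> 1" using \<xi> i by (force simp: configs_def)
  have S2: "S \<ge> 2" using total_ge[OF \<xi>] N by (simp add: S_def)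
  have \<psi>1: "\<psi> \<ge> 1" using psi_ge_1[OF \<xi>] N by (simp add: \<psi>_def)
  have G0: "G (\<xi> i) = 0" by (simp add: G_def)
  have disp: "real (\<xi> i + k - 1) - real (\<xi> i) = real k - 1" for k
    using a1 by simp
  have "(\<lambda>k. pmf p k * G (\<xi> i + k - 1)) summable_on UNIV"
  proof (rule summable_on_iff_abs_summable_on_real[THEN iffD2], rule Infinite_Sum.abs_summable_on_comparison_test')
    show "(\<lambda>k. (2 * a + 1 + \<psi>) * (pmf p k * (real k - 1)\<^sup>2)) summable_on UNIV"
      using second by (intro summable_on_cmult_right) (auto simp: summable_on_def)
    fix k
    define d where "d = real k - 1"
    have d: "\<bar>d\<bar> \<le> d\<^sup>2" "d \<ge> -1"
      unfolding d_def by (intro abs_le_square_if_Ints) auto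
    have "G (\<xi> i + k - 1) = d * (2 * a + d - \<psi>) / (S + d)"
    proof -
      have "real (\<xi> i + k - 1) + real (\<xi> i) = 2 * a + d"
        using disp[of k] by (simp add: a_def d_def)
      then show ?thesis
        using psi_increment[OF i, of \<xi> "\<xi> i + k - 1"] disp[of k] S2 d(2)
        by (simp add: G_def S_def \<psi>_def d_def)
    qed
    also have "\<bar>\<dots>\<bar> \<le> \<bar>d * (2 * a + d - \<psi>)\<bar>"
      using S2 d(2) divide_left_mono[of 1 "S + d" "\<bar>d * (2 * a + d - \<psi>)\<bar>"]
      by (simp add: abs_divide)
    also have "\<dots> \<le> \<bar>d\<bar> * (2 * a + \<psi>) + d\<^sup>2"
    proof -
      have "\<bar>2 * a + d - \<psi>\<bar> \<le> (2 * a + \<psi>) + \<bar>d\<bar>"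
        using \<psi>1 by (simp add: a_def)
      then have "\<bar>d\<bar> * \<bar>2 * a + d - \<psi>\<bar> \<le> \<bar>d\<bar> * ((2 * a + \<psi>) + \<bar>d\<bar>)"
        by (intro mult_left_mono) auto
      then show ?thesis
        by (simp add: abs_mult distrib_left power2_eq_square)
    qed
    also have "\<dots> \<le> d\<^sup>2 * (2 * a + \<psi>) + d\<^sup>2"
      using mult_right_mono[OF d(1), of "2 * a + \<psi>"] \<psi>1 by (simp add: a_def)
    finally have G_le: "\<bar>G (\<xi> i + k - 1)\<bar> \<le> (2 * a + 1 + \<psi>) * d\<^sup>2"
      by (simp add: algebra_simps)
    show "norm (pmf p k * G (\<xi> i + k - 1)) \<le> (2 * a + 1 + \<psi>) * (pmf p k * (real k - 1)\<^sup>2)"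
      using mult_left_mono[OF G_le, of "pmf p k"]
      by (simp add: abs_mult d_def mult.left_commute)
  qed
  then have sumG: "((\<lambda>y. gw_rate p (\<xi> i) y * G y) has_sum
      (real (\<xi> i) * (\<Sum>\<^sub>\<infinity>k. pmf p k * G (\<xi> i + k - 1))
        - (if \<xi> i = 1 then pmf p 0 * G 0 else 0))) {1..}"
    by (intro has_sum_gw_rate a1 G0 has_sum_infsum)
  then show "(\<lambda>y. gw_rate p (\<xi> i) y * G y) summable_on {1..}"
    by (auto simp: summable_on_def)

  define B where "B = (\<lambda>y. increment_bound S \<psi> a (real y - a))"
  have B_eq: "B (\<xi> i + k - 1)
      = (2 * a - \<psi>) / S * (real k - 1) + (1 / S + 2 * \<psi> / S\<^sup>2) * (real k - 1)\<^sup>2" for k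
    unfolding B_def increment_bound_def a_def disp
    by (simp add: add_divide_distrib diff_divide_distrib algebra_simps power2_eq_square)
  have "((\<lambda>k. (2 * a - \<psi>) / S * (pmf p k * (real k - 1))
          + (1 / S + 2 * \<psi> / S\<^sup>2) * (pmf p k * (real k - 1)\<^sup>2))
      has_sum ((2 * a - \<psi>) / S * (- \<mu>) + (1 / S + 2 * \<psi> / S\<^sup>2) * s)) UNIV"
    by (intro has_sum_add has_sum_cmult_right drift second)
  also have "(\<lambda>k. (2 * a - \<psi>) / S * (pmf p k * (real k - 1))
          + (1 / S + 2 * \<psi> / S\<^sup>2) * (pmf p k * (real k - 1)\<^sup>2))
      = (\<lambda>k. pmf p k * B (\<xi> i + k - 1))"
    unfolding B_eq by (simp only: distrib_left mult.left_commute)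
  finally have sumB: "((\<lambda>y. gw_rate p (\<xi> i) y * B y) has_sum
      (real (\<xi> i) * ((2 * a - \<psi>) / S * (- \<mu>) + (1 / S + 2 * \<psi> / S\<^sup>2) * s)
        - (if \<xi> i = 1 then pmf p 0 * B 0 else 0))) {1..}"
    by (intro has_sum_gw_rate a1) (auto simp: B_def increment_bound_def a_def)
  have "gw_rate p (\<xi> i) y * G y \<le> gw_rate p (\<xi> i) y * B y" for y
  proof (cases "y + 1 \<ge> \<xi> i")
    case True
    have "G y \<le> B y"
      using psi_increment_le[OF \<xi> N i True] by (simp add: G_def B_def S_def \<psi>_def a_def)
    then show ?thesis
      by (intro mult_left_mono) (auto simp: gw_rate_def)
  qed (simp add: gw_rate_def)
  then have "(\<Sum>\<^sub>\<infinity>y\<in>{1..}. gw_rate p (\<xi> i) y * G y)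
      \<le> a * ((2 * a - \<psi>) / S * (- \<mu>) + (1 / S + 2 * \<psi> / S\<^sup>2) * s)
        - (if \<xi> i = 1 then pmf p 0 * B 0 else 0)"
    using has_sum_mono[OF sumG sumB] infsumI[OF sumG] by (simp add: a_def)
  moreover have "pmf p 0 * B 0 \<ge> pmf p 0 * (\<psi> - 1) / S" if "\<xi> i = 1"
  proof -
    have "B 0 = (\<psi> - 1) / S + 2 * \<psi> / S\<^sup>2"
      using that by (simp add: B_def increment_bound_def a_def)
    then have "B 0 \<ge> (\<psi> - 1) / S" using \<psi>1 by simp
    then show ?thesis using mult_left_mono[of _ _ "pmf p 0"] by fastforce
  qed
  ultimately show "(\<Sum>\<^sub>\<infinity>y\<in>{1..}. gw_rate p (\<xi> i) y * G y)
      \<le> a * (- \<mu> * (2 * a - \<psi>) / S + s * (1 / S + 2 * \<psi> / S\<^sup>2))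
         - (if \<xi> i = 1 then pmf p 0 * (\<psi> - 1) / S else 0)"
    by (auto simp: algebra_simps split: if_splits)
qed

text \<open>The selection part. The leading terms add up to a multiple of \<open>\<psi> - 1\<close> because the sum of
  \<open>(\<xi> j)\<^sup>2\<close> is \<open>\<psi> * S\<close>, which cancels \<open>\<psi>\<close> times the sum of \<open>\<xi> j\<close>.\<close>
lemma copying_sum_le:
  assumes \<xi>: "\<xi> \<in> configs N" and N: "N \<ge> 2" and i: "i \<in> {1..N}" and at1: "\<xi> i = 1"
  defines "S \<equiv> total N \<xi>" and "\<psi> \<equiv> psi N \<xi>"
  shows "(\<Sum>j=1..N. psi N (\<xi>(i := \<xi> j)) - psi N \<xi>) \<le> (real N * (\<psi> - 1) + 2 * \<psi>\<^sup>2) / S"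
proof -
  have S2: "S \<ge> 2" using total_ge[OF \<xi>] N by (simp add: S_def)
  have \<psi>1: "\<psi> \<ge> 1" using psi_ge_1[OF \<xi>] N by (simp add: \<psi>_def)
  have Q: "(\<Sum>j=1..N. (real (\<xi> j))\<^sup>2) = \<psi> * S"
    using psi_mult_total[of N \<xi>] S2 by (simp add: S_def \<psi>_def)
  have lin: "(\<Sum>j=1..N. real (\<xi> j)) = S" by (simp add: S_def total_def)
  have "psi N (\<xi>(i := \<xi> j)) - psi N \<xi>
      \<le> ((real (\<xi> j))\<^sup>2 - 1 - \<psi> * (real (\<xi> j) - 1)) / S + (2 * \<psi> / S\<^sup>2) * (real (\<xi> j))\<^sup>2"
    if j: "j \<in> {1..N}" for j
  proof -
    have b: "\<xi> j \<ge> 1" using \<xi> j by (force simp: configs_def)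
    have "psi N (\<xi>(i := \<xi> j)) - psi N \<xi> \<le> increment_bound S \<psi> 1 (real (\<xi> j) - 1)"
      using psi_increment_le[OF \<xi> N i, of "\<xi> j"] at1 by (simp add: S_def \<psi>_def)
    also have "\<dots> = ((real (\<xi> j))\<^sup>2 - 1 - \<psi> * (real (\<xi> j) - 1)) / S
        + (2 * \<psi> / S\<^sup>2) * (real (\<xi> j) - 1)\<^sup>2"
    proof -
      have "(x - 1) * (2 * 1 + (x - 1) - \<psi>) = x\<^sup>2 - 1 - \<psi> * (x - 1)" for x :: real
        by (simp add: algebra_simps power2_eq_square)
      then show ?thesis unfolding increment_bound_def by simp
    qed
    also have "(2 * \<psi> / S\<^sup>2) * (real (\<xi> j) - 1)\<^sup>2 \<le> (2 * \<psi> / S\<^sup>2) * (real (\<xi> j))\<^sup>2"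
      using b \<psi>1 by (intro mult_left_mono power_mono) auto
    finally show ?thesis by simp
  qed
  then have "(\<Sum>j=1..N. psi N (\<xi>(i := \<xi> j)) - psi N \<xi>)
      \<le> (\<Sum>j=1..N. ((real (\<xi> j))\<^sup>2 - 1 - \<psi> * (real (\<xi> j) - 1)) / S
            + (2 * \<psi> / S\<^sup>2) * (real (\<xi> j))\<^sup>2)"
    by (intro sum_mono)
  also have "\<dots> = (\<psi> * S - real N - \<psi> * (S - real N)) / S + (2 * \<psi> / S\<^sup>2) * (\<psi> * S)"
    unfolding sum.distrib sum_distrib_left[symmetric] sum_divide_distrib[symmetric]
      sum_subtractf Q lin by simp
  also have "\<dots> = (real N * (\<psi> - 1) + 2 * \<psi>\<^sup>2) / S"
    using S2 by (simp add: field_simps power2_eq_square)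
  finally show ?thesis .
qed

text \<open>Branching and selection together. For a particle at site 1, the gain from the suppressed
  extinction cancels the leading cost of copying up to the factor \<open>N / (N - 1) - 1 = 1 / (N - 1)\<close>.\<close>
lemma particle_contribution_le:
  fixes p :: "nat pmf"
  assumes \<xi>: "\<xi> \<in> configs N" and N: "N \<ge> 2" and i: "i \<in> {1..N}"
    and drift: "((\<lambda>k. pmf p k * (real k - 1)) has_sum - \<mu>) UNIV"
    and second: "((\<lambda>k. pmf p k * (real k - 1)\<^sup>2) has_sum s) UNIV"
  defines "S \<equiv> total N \<xi>" and "\<psi> \<equiv> psi N \<xi>" and "a \<equiv> real (\<xi> i)"
  shows "(\<Sum>\<^sub>\<infinity>y\<in>{1..}.
        (gw_rate p (\<xi> i) y + gw_rate p (\<xi> i) 0 * (real N / (real N - 1)) * emp_measure N y \<xi>)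
        * (psi N (\<xi>(i := y)) - psi N \<xi>))
      \<le> a * (- \<mu> * (2 * a - \<psi>) / S + s * (1 / S + 2 * \<psi> / S\<^sup>2))
        + 3 * pmf p 0 * \<psi>\<^sup>2 / ((real N - 1) * S)"
    (is "?lhs \<le> ?main + ?err")
proof -
  define G where "G y = psi N (\<xi>(i := y)) - psi N \<xi>" for y
  define c where "c = gw_rate p (\<xi> i) 0 * (real N / (real N - 1))"
  define T where "T = (\<Sum>j=1..N. G (\<xi> j))"
  have pos: "\<xi> j \<ge> 1" if "j \<in> {1..N}" for j using \<xi> that by (force simp: configs_def)
  have S2: "S \<ge> 2" using total_ge[OF \<xi>] N by (simp add: S_def)
  have \<psi>1: "\<psi> \<ge> 1" using psi_ge_1[OF \<xi>] N by (simp add: \<psi>_def)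
  note branch = branching_sum_le[OF \<xi> N i drift second, folded G_def S_def \<psi>_def a_def]
  have "((\<lambda>y. gw_rate p (\<xi> i) y * G y + c * (emp_measure N y \<xi> * G y)) has_sum
      ((\<Sum>\<^sub>\<infinity>y\<in>{1..}. gw_rate p (\<xi> i) y * G y) + c * (T / real N))) {1..}"
    unfolding T_def
    by (intro has_sum_add has_sum_infsum branch(1) has_sum_cmult_right has_sum_emp_measure pos)
  then have "?lhs = (\<Sum>\<^sub>\<infinity>y\<in>{1..}. gw_rate p (\<xi> i) y * G y) + c * (T / real N)"
    unfolding G_def[symmetric] c_def[symmetric] distrib_right mult.assoc[of c] by (rule infsumI)
  also have "\<dots> \<le> ?main - (if \<xi> i = 1 then pmf p 0 * (\<psi> - 1) / S else 0) + c * (T / real N)"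
    using branch(2) by simp
  also have "\<dots> \<le> ?main + ?err"
  proof (cases "\<xi> i = 1")
    case True
    have "c * (T / real N) = pmf p 0 / (real N - 1) * T"
      using True N by (simp add: c_def gw_rate_def)
    also have "\<dots> \<le> pmf p 0 / (real N - 1) * ((real N * (\<psi> - 1) + 2 * \<psi>\<^sup>2) / S)"
      using copying_sum_le[OF \<xi> N i True] N
      by (intro mult_left_mono) (auto simp: T_def G_def S_def \<psi>_def)
    also have "\<dots> = pmf p 0 * (\<psi> - 1) / S + pmf p 0 * (\<psi> - 1 + 2 * \<psi>\<^sup>2) / ((real N - 1) * S)"
      using N S2 by (simp add: divide_simps) (simp add: algebra_simps)
    also have "pmf p 0 * (\<psi> - 1 + 2 * \<psi>\<^sup>2) / ((real N - 1) * S) \<le> ?err"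
    proof -
      have "\<psi> - 1 \<le> \<psi>\<^sup>2"
        using self_le_power[OF \<psi>1, of 2] by simp
      then have "pmf p 0 * (\<psi> - 1 + 2 * \<psi>\<^sup>2) \<le> pmf p 0 * (3 * \<psi>\<^sup>2)"
        by (intro mult_left_mono) auto
      then show ?thesis
        using N S2 by (intro divide_right_mono) auto
    qed
    finally show ?thesis using True by simp
  next
    case False
    then have "c = 0" using pos[OF i] by (simp add: c_def gw_rate_def)
    then show ?thesis using False N S2 by simp
  qed
  finally show ?thesis .
qed

section \<open>The drift inequality\<close>

text \<open>Summing over the particles, with \<open>v = \<mu>\<close>. The error terms are estimated with \<open>\<psi> \<le> R\<close>,
  \<open>N \<le> S\<close> and \<open>1 / (N - 1) \<le> 2 / N\<close>.\<close>
lemma fv_gen_psi_le: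
  fixes p :: "nat pmf"
  assumes \<xi>: "\<xi> \<in> configs N" and N: "N \<ge> 2" and s: "s \<ge> 0"
    and drift: "((\<lambda>k. pmf p k * (real k - 1)) has_sum - \<mu>) UNIV"
    and second: "((\<lambda>k. pmf p k * (real k - 1)\<^sup>2) has_sum s) UNIV"
  shows "fv_gen p N (psi N) \<xi>
    \<le> - \<mu> * psi N \<xi> + (2 * s + 6 * pmf p 0) * ((real (rightmost N \<xi>))\<^sup>2 / real N) + s"
proof -
  define S where "S = total N \<xi>"
  define \<psi> where "\<psi> = psi N \<xi>"
  define R where "R = real (rightmost N \<xi>)"
  define c where "c = s * (1 / S + 2 * \<psi> / S\<^sup>2)"
  have NS: "real N \<le> S" using total_ge[OF \<xi>] by (simp add: S_def)
  have S2: "S \<ge> 2" using NS N by simp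
  have \<psi>1: "\<psi> \<ge> 1" using psi_ge_1[OF \<xi>] N by (simp add: \<psi>_def)
  have \<psi>R: "\<psi> \<le> R" using psi_le_rightmost[OF \<xi>] N by (simp add: \<psi>_def R_def)
  have Q: "(\<Sum>i=1..N. (real (\<xi> i))\<^sup>2) = \<psi> * S"
    using psi_mult_total[of N \<xi>] S2 by (simp add: S_def \<psi>_def)
  have lin: "(\<Sum>i=1..N. real (\<xi> i)) = S" by (simp add: S_def total_def)
  have "fv_gen p N (psi N) \<xi>
      \<le> (\<Sum>i=1..N. real (\<xi> i) * (- \<mu> * (2 * real (\<xi> i) - \<psi>) / S + c)
            + 3 * pmf p 0 * \<psi>\<^sup>2 / ((real N - 1) * S))"
    unfolding fv_gen_def
    using particle_contribution_le[OF \<xi> N _ drift second]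
    by (intro sum_mono) (simp add: S_def \<psi>_def c_def)
  also have "\<dots> = (\<Sum>i=1..N. (- 2 * \<mu> / S) * (real (\<xi> i))\<^sup>2 + (\<mu> * \<psi> / S + c) * real (\<xi> i)
            + 3 * pmf p 0 * \<psi>\<^sup>2 / ((real N - 1) * S))"
    by (intro sum.cong refl) (simp add: add_divide_distrib diff_divide_distrib algebra_simps
        power2_eq_square)
  also have "\<dots> = (- 2 * \<mu> / S) * (\<psi> * S) + (\<mu> * \<psi> / S + c) * S
            + real N * (3 * pmf p 0 * \<psi>\<^sup>2 / ((real N - 1) * S))"
    unfolding sum.distrib sum_distrib_left[symmetric] Q lin by simp
  also have "\<dots> = - \<mu> * \<psi> + s + 2 * s * (\<psi> / S)
      + 3 * pmf p 0 * ((real N / S) * (\<psi>\<^sup>2 / (real N - 1)))"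
    using S2 by (simp add: c_def field_simps power2_eq_square)
  also have "\<dots> \<le> - \<mu> * \<psi> + s + 2 * s * (R\<^sup>2 / real N)
      + 3 * pmf p 0 * (1 * (R\<^sup>2 / (real N / 2)))"
  proof (rule add_mono[OF add_mono[OF order.refl mult_left_mono] mult_left_mono])
    show "\<psi> / S \<le> R\<^sup>2 / real N"
    proof (rule frac_le)
      have "R \<le> R\<^sup>2"
        using \<psi>1 \<psi>R by (intro self_le_power) auto
      with \<psi>R show "\<psi> \<le> R\<^sup>2" by simp
    qed (use NS N in auto)
    show "(real N / S) * (\<psi>\<^sup>2 / (real N - 1)) \<le> 1 * (R\<^sup>2 / (real N / 2))"
      using NS S2 N \<psi>1 \<psi>R by (intro mult_mono frac_le power_mono) auto
  qed (use s in auto)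
  finally show ?thesis
    by (simp add: \<psi>_def R_def algebra_simps)
qed

theorem proposition1p3:
  fixes p :: "nat pmf"
  assumes "exp_moment p" and "subcritical p"
  shows "\<exists>v C\<^sub>1 C\<^sub>2 :: real. v > 0 \<and> C\<^sub>1 > 0 \<and> C\<^sub>2 > 0 \<and>
    (\<forall>N::nat. N \<ge> 2 \<longrightarrow> (\<forall>\<xi>\<in>configs N.
       fv_gen p N (psi N) \<xi>
         \<le> - v * psi N \<xi> + C\<^sub>1 * ((real (rightmost N \<xi>))\<^sup>2 / real N) + C\<^sub>2))"
proof -
  obtain \<mu> s where \<mu>: "\<mu> > 0" and s: "s \<ge> 0"
    and drift: "((\<lambda>k. pmf p k * (real k - 1)) has_sum - \<mu>) UNIV"
    and second: "((\<lambda>k. pmf p k * (real k - 1)\<^sup>2) has_sum s) UNIV"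
    using displacement_moments[OF assms] by blast
  (* The summands 1 only make the constants strictly positive. *)
  have "fv_gen p N (psi N) \<xi>
      \<le> - \<mu> * psi N \<xi> + (2 * s + 6 * pmf p 0 + 1) * ((real (rightmost N \<xi>))\<^sup>2 / real N) + (s + 1)"
    if "N \<ge> 2" "\<xi> \<in> configs N" for N \<xi>
  proof -
    have "0 \<le> (real (rightmost N \<xi>))\<^sup>2 / real N" by simp
    then show ?thesis
      using fv_gen_psi_le[OF that(2,1) s drift second] unfolding distrib_right by linarith
  qed
  moreover have "2 * s + 6 * pmf p 0 + 1 > 0" "s + 1 > 0"
    using s by (simp_all add: add_nonneg_pos)
  ultimately show ?thesis using \<mu> by blast
qed

end
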